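(* Suppose $P\in\mathbb{S}^{n+m}$ satisfies $P\succeq P^*$. Then $$0\preceq\mathcal{T}^k(P)-P^*\preceq\gamma^k(A(F^* )^T)^k(P-P^* )A(F^* )^k\quad\text{for all integers }k\ge 0,$$ and $\gamma^k(A(F^* )^T)^k(P-P^* )A(F^* )^k\to 0$ as $k\to\infty$.
   Context: $\mathbb{S}^N$ denotes the real symmetric $N\times N$ matrices; $\mathbb{S}^N_+$, $\mathbb{S}^N_{++}$ are the positive semidefinite and positive definite ones; $\preceq,\succeq$ is the Loewner order. Fix $A\in\mathbb{R}^{n\times n}$, $B\in\mathbb{R}^{n\times m}$, a discount factor $\gamma\in(0,1]$, $Q\in\mathbb{S}^n$ with $Q\succeq 0$, $R\in\mathbb{S}^m$ with $R\succ 0$. Standing assumption: $(A,B)$ is stabilizable and $Q=C^TC$ for some matrix $C$ with $(A,C)$ detectable (discrete-time sense). Put $\Lambda=\begin{bmatrix}Q & 0 \\ 0 & R\end{bmatrix}$ and, for $F\in\mathbb{R}^{m\times n}$, $A(F)=\begin{bmatrix}A & B \\ F A & F B\end{bmatrix}\in\mathbb{R}^{(n+m)\times(n+m)}$. $X^*$ is the unique solution $X\succeq 0$ of the algebraic Riccati equation $X=\gamma A^TXA-\gamma A^TXB(R+\gamma B^TXB)^{-1}\gamma B^TXA+Q$; $F^*=-(R+\gamma B^TX^*B)^{-1}\gamma B^TX^*A$ (which satisfies $\rho(\gamma^{1/2}(A+BF^* ))<1$); and $P^*=\begin{bmatrix}Q+\gamma A^TX^*A & \gamma A^TX^*B \\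 \gamma B^TX^*A & R+\gamma B^TX^*B\end{bmatrix}$, which satisfies $P^*=\Lambda+\gamma A(F^* )^TP^*A(F^* )$. Matrices $P\in\mathbb{S}^{n+m}$ are partitioned as $P=\begin{bmatrix}P_{11} & P_{12} \\ P_{12}^T & P_{22}\end{bmatrix}$ with $P_{11}\in\mathbb{S}^n$, $P_{12}\in\mathbb{R}^{n\times m}$, $P_{22}\in\mathbb{S}^m$. $\mathcal{P}=\{P\in\mathbb{S}^{n+m}_+:P_{22}\in\mathbb{S}^m_{++}\}$ (it contains every symmetric $P\succeq P^*$). The Bellman operator is $\mathcal{T}(P)=\Lambda+\gamma A(-P_{22}^{-1}P_{12}^T)^TPA(-P_{22}^{-1}P_{12}^T)$ for $P\in\mathcal{P}$, and $\mathcal{T}(0)=\Lambda$; it maps $\mathcal{P}\cup\{0\}$ into $\mathcal{P}$, and $\mathcal{T}^k$ is its $k$-fold composition. *)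

theory Defs
  imports "HOL-Analysis.Analysis"
begin

definition sym_mat :: "real^'n^'n \<Rightarrow> bool" where
  "sym_mat M \<longleftrightarrow> transpose M = M"

definition psd :: "real^'n^'n \<Rightarrow> bool" where
  "psd M \<longleftrightarrow> sym_mat M \<and> (\<forall>x. 0 \<le> x \<bullet> (M *v x))"

definition pos_def :: "real^'n^'n \<Rightarrow> bool" where
  "pos_def M \<longleftrightarrow> sym_mat M \<and> (\<forall>x. x \<noteq> 0 \<longrightarrow> 0 < x \<bullet> (M *v x))"

definition loewner_le :: "real^'n^'n \<Rightarrow> real^'n^'n \<Rightarrow> bool" (infix "\<preceq>" 50) where
  "M \<preceq> N \<longleftrightarrow> psd (N - M)"

text \<open>The operation \<open>*\<close> on \<open>real^'n^'n\<close> is componentwise, so \<open>M ^ k\<close> is not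
  the matrix power.\<close>

primrec matpow :: "real^'n^'n \<Rightarrow> nat \<Rightarrow> real^'n^'n" where
  "matpow M 0 = mat 1"
| "matpow M (Suc k) = M ** matpow M k"

definition block_mat ::
  "real^'n^'n \<Rightarrow> real^'m^'n \<Rightarrow> real^'n^'m \<Rightarrow> real^'m^'m \<Rightarrow> real^('n::finite + 'm::finite)^('n + 'm)" where
  "block_mat M11 M12 M21 M22 =
    (\<chi> i j. case i of
        Inl a \<Rightarrow> (case j of Inl b \<Rightarrow> M11 $ a $ b | Inr b \<Rightarrow> M12 $ a $ b)
      | Inr a \<Rightarrow> (case j of Inl b \<Rightarrow> M21 $ a $ b | Inr b \<Rightarrow> M22 $ a $ b))"

definition block12 :: "real^('n::finite + 'm::finite)^('n + 'm) \<Rightarrow> real^'m^'n" where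
  "block12 P = (\<chi> i j. P $ Inl i $ Inr j)"

definition block22 :: "real^('n::finite + 'm::finite)^('n + 'm) \<Rightarrow> real^'m^'m" where
  "block22 P = (\<chi> i j. P $ Inr i $ Inr j)"

text \<open>Eigenvalues are the complex ones: the spectral radius of \<open>M\<close> is less than one.\<close>

definition schur_stable :: "real^'n^'n \<Rightarrow> bool" where
  "schur_stable M \<longleftrightarrow>
    (\<forall>(\<mu>::complex) (v::complex^'n).
      v \<noteq> 0 \<and> (\<chi> i j. complex_of_real (M $ i $ j)) *v v = \<mu> *s v \<longrightarrow> cmod \<mu> < 1)"

definition stabilizable :: "real^'n^'n \<Rightarrow> real^'m^'n \<Rightarrow> bool" where
  "stabilizable A B \<longleftrightarrow> (\<exists>K :: real^'n^'m. schur_stable (A + B ** K))"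

definition detectable :: "real^'n^'n \<Rightarrow> real^'n^'p \<Rightarrow> bool" where
  "detectable A C \<longleftrightarrow> (\<exists>L :: real^'p^'n. schur_stable (A + L ** C))"

definition cost_mat :: "real^'n^'n \<Rightarrow> real^'m^'m \<Rightarrow> real^('n::finite + 'm::finite)^('n + 'm)" where
  "cost_mat Q R = block_mat Q 0 0 R"

definition aug_mat ::
  "real^'n^'n \<Rightarrow> real^'m^'n \<Rightarrow> real^'n^'m \<Rightarrow> real^('n::finite + 'm::finite)^('n + 'm)" where
  "aug_mat A B F = block_mat A B (F ** A) (F ** B)"

definition riccati_solution ::
  "real^'n^'n \<Rightarrow> real^'m^'n \<Rightarrow> real \<Rightarrow> real^'n^'n \<Rightarrow> real^'m^'m \<Rightarrow> real^'n^'n \<Rightarrow> bool" where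
  "riccati_solution A B \<gamma> Q R X \<longleftrightarrow>
    X = \<gamma> *\<^sub>R (transpose A ** X ** A)
        - (\<gamma> *\<^sub>R (transpose A ** X ** B))
          ** matrix_inv (R + \<gamma> *\<^sub>R (transpose B ** X ** B))
          ** (\<gamma> *\<^sub>R (transpose B ** X ** A))
        + Q"

definition riccati_gain ::
  "real^'n^'n \<Rightarrow> real^'m^'n \<Rightarrow> real \<Rightarrow> real^'m^'m \<Rightarrow> real^'n^'n \<Rightarrow> real^'n^'m" where
  "riccati_gain A B \<gamma> R X =
    - (matrix_inv (R + \<gamma> *\<^sub>R (transpose B ** X ** B)) ** (\<gamma> *\<^sub>R (transpose B ** X ** A)))"

definition riccati_Qmat ::
  "real^'n^'n \<Rightarrow> real^'m^'n \<Rightarrow> real \<Rightarrow> real^'n^'n \<Rightarrow> real^'m^'m \<Rightarrow> real^'n^'n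
    \<Rightarrow> real^('n::finite + 'm::finite)^('n + 'm)" where
  "riccati_Qmat A B \<gamma> Q R X =
    block_mat (Q + \<gamma> *\<^sub>R (transpose A ** X ** A)) (\<gamma> *\<^sub>R (transpose A ** X ** B))
              (\<gamma> *\<^sub>R (transpose B ** X ** A)) (R + \<gamma> *\<^sub>R (transpose B ** X ** B))"

definition bellman_dom :: "(real^('n::finite + 'm::finite)^('n + 'm)) set" where
  "bellman_dom = {P. psd P \<and> pos_def (block22 P)}"

definition greedy_gain :: "real^('n::finite + 'm::finite)^('n + 'm) \<Rightarrow> real^'n^'m" where
  "greedy_gain P = - (matrix_inv (block22 P) ** transpose (block12 P))"

text \<open>The Bellman operator is partial, with domain \<open>bellman_dom \<union> {0}\<close>; outside this set
  its value is left unspecified.\<close>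

definition bellman ::
  "real^'n^'n \<Rightarrow> real^'m^'n \<Rightarrow> real \<Rightarrow> real^'n^'n \<Rightarrow> real^'m^'m
    \<Rightarrow> real^('n::finite + 'm::finite)^('n + 'm) \<Rightarrow> real^('n::finite + 'm::finite)^('n + 'm)" where
  "bellman A B \<gamma> Q R P =
    (if P \<in> bellman_dom then
       cost_mat Q R + \<gamma> *\<^sub>R (transpose (aug_mat A B (greedy_gain P)) ** P
                              ** aug_mat A B (greedy_gain P))
     else if P = 0 then cost_mat Q R
     else undefined)"

end

theory Submission
  imports Defs "HOL-Computational_Algebra.Fundamental_Theorem_Algebra"
begin

text \<open>
  Value iteration for the discounted linear quadratic regulator, started above the optimal Q-matrix
  \<open>Pstar\<close>, stays above it and approaches it at the rate of the optimal closed loop.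

  The sandwich rests on one observation: for \<open>P\<close> in the domain, completion of squares shows that the
  greedy gain minimizes the quadratic form of \<open>P\<close> over all inputs (\<open>greedy_gain_minimizes\<close>), so the
  Bellman operator is the minimum over gains \<open>F\<close> of the affine monotone operators
  \<open>P \<mapsto> \<Lambda> + \<gamma> A(F)\<^sup>T P A(F)\<close>. The Riccati equation makes \<open>Pstar\<close> the fixed point of the operator for
  \<open>F = Fstar\<close>, and \<open>Fstar\<close> is greedy for \<open>Pstar\<close>. Using \<open>Fstar\<close> as a competitor for \<open>P\<close> bounds
  \<open>T P - Pstar\<close> above by \<open>\<gamma> A(Fstar)\<^sup>T (P - Pstar) A(Fstar)\<close>; using the gain greedy for \<open>P\<close> as a
  competitor for \<open>Pstar\<close> shows \<open>T P \<succeq> Pstar\<close>. Both bounds iterate, since the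
  domain contains every symmetric matrix above \<open>Pstar\<close> (\<open>bellman_dom_mono\<close>). All comparisons are made between values of
  quadratic forms.

  For the limit, \<open>\<surd>\<gamma> A(Fstar)\<close> has spectral radius less than one (\<open>schur_stable_closed_loop\<close>): the
  fixed point equation of \<open>Pstar\<close> is a Lyapunov equation, so an eigenvector for an eigenvalue outside
  the open unit disc must incur no stage cost, and detectability excludes this. That the powers
  of such a matrix vanish in the limit (\<open>schur_stable_matpow_tendsto_0\<close>) is obtained from the
  factorization of a polynomial annihilating an orbit, one root at a time.
\<close>

section \<open>Powers of a matrix with spectral radius less than one\<close>

text \<open>A contraction forgets its past: past a time after which the perturbations stay below
\<open>\<epsilon> / 2 * (1 - \<bar>\<mu>\<bar>)\<close>, their accumulated effect is bounded by the geometric series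
\<open>\<epsilon> / 2\<close>, and the initial value is damped by powers of \<open>\<mu>\<close>.\<close>
lemma perturbed_contraction_tendsto_0:
  fixes u e :: "nat \<Rightarrow> complex"
  assumes rec: "\<And>k. u (Suc k) = \<mu> * u k + e k" and "cmod \<mu> < 1" and e: "e \<longlonglongrightarrow> 0"
  shows "u \<longlonglongrightarrow> 0"
proof (rule LIMSEQ_I)
  fix \<epsilon> :: real assume "0 < \<epsilon>"
  define \<delta> where "\<delta> = \<epsilon> / 2 * (1 - cmod \<mu>)"
  have "0 < \<delta>" using \<open>0 < \<epsilon>\<close> assms(2) by (simp add: \<delta>_def)
  with e obtain N where N: "\<And>k. N \<le> k \<Longrightarrow> cmod (e k) < \<delta>"
    using LIMSEQ_D by fastforce
  have bound: "cmod (u (N + j)) \<le> cmod \<mu> ^ j * cmod (u N) + \<epsilon> / 2" for j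
  proof (induction j)
    case 0
    then show ?case using \<open>0 < \<epsilon>\<close> by simp
  next
    case (Suc j)
    have "cmod (u (N + Suc j)) \<le> cmod \<mu> * cmod (u (N + j)) + cmod (e (N + j))"
      using norm_triangle_ineq[of "\<mu> * u (N + j)" "e (N + j)"] rec[of "N + j"]
      by (simp add: norm_mult)
    also have "\<dots> \<le> cmod \<mu> * (cmod \<mu> ^ j * cmod (u N) + \<epsilon> / 2) + \<delta>"
      using Suc N[of "N + j"] by (intro add_mono mult_left_mono) auto
    also have "\<dots> = cmod \<mu> ^ Suc j * cmod (u N) + \<epsilon> / 2"
      by (simp add: \<delta>_def field_simps)
    finally show ?case .
  qed
  have "(\<lambda>j. cmod \<mu> ^ j * cmod (u N)) \<longlonglongrightarrow> 0 * cmod (u N)"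
    by (intro tendsto_intros LIMSEQ_power_zero) (use assms(2) in simp)
  then obtain J where J: "\<And>j. J \<le> j \<Longrightarrow> cmod \<mu> ^ j * cmod (u N) < \<epsilon> / 2"
    using \<open>0 < \<epsilon>\<close> LIMSEQ_D[of _ 0 "\<epsilon> / 2"] by fastforce
  show "\<exists>no. \<forall>n\<ge>no. norm (u n - 0) < \<epsilon>"
  proof (intro exI allI impI)
    fix n assume n: "N + J \<le> n"
    then show "norm (u n - 0) < \<epsilon>"
      using bound[of "n - N"] J[of "n - N"] by (simp add: le_diff_conv2 add.commute)
  qed
qed

text \<open>The evaluation of a polynomial at a matrix, applied to a vector. Powers of the matrix are
  written as iterates of the linear map, because the ring multiplication on \<open>complex^'n^'n\<close> is
  componentwise, so that \<open>poly\<close> over matrices would mean something else.\<close>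
definition poly_act :: "complex^'n^'n \<Rightarrow> complex poly \<Rightarrow> complex^'n \<Rightarrow> complex^'n" where
  "poly_act M p x = (\<Sum>i\<le>degree p. coeff p i *s (((*v) M ^^ i) x))"

lemma poly_act_eq_sum:
  assumes "degree p \<le> n"
  shows "poly_act M p x = (\<Sum>i\<le>n. coeff p i *s (((*v) M ^^ i) x))"
  unfolding poly_act_def
  by (rule sum.mono_neutral_left) (use assms in \<open>auto simp: coeff_eq_0\<close>)

lemma matrix_vector_mult_sum: "M *v (\<Sum>i\<in>I. f i) = (\<Sum>i\<in>I. M *v (f i :: complex^'n))"
  by (induction I rule: infinite_finite_induct) (simp_all add: algebra_simps)

lemma poly_act_pCons: "poly_act M (pCons a p) x = a *s x + M *v poly_act M p x"
proof -
  have "poly_act M (pCons a p) x =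
      (\<Sum>i\<le>Suc (degree p). coeff (pCons a p) i *s (((*v) M ^^ i) x))"
    by (rule poly_act_eq_sum) (rule degree_pCons_le)
  also have "\<dots> = a *s x + (\<Sum>i\<le>degree p. coeff p i *s (M *v (((*v) M ^^ i) x)))"
    by (simp add: sum.atMost_Suc_shift del: sum.atMost_Suc)
  also have "(\<Sum>i\<le>degree p. coeff p i *s (M *v (((*v) M ^^ i) x))) = M *v poly_act M p x"
    by (simp add: poly_act_def matrix_vector_mult_sum vector_scalar_commute)
  finally show ?thesis .
qed

lemma poly_act_add: "poly_act M (p + q) x = poly_act M p x + poly_act M q x"
proof -
  let ?n = "max (degree p) (degree q)"
  show ?thesis
    by (simp add: poly_act_eq_sum[of _ ?n] degree_add_le_max vec.scale_left_distrib sum.distrib)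
qed

lemma poly_act_smult: "poly_act M (smult a p) x = a *s poly_act M p x"
  by (simp add: poly_act_eq_sum[of _ "degree p"] vec.scale_sum_right)

lemma poly_act_linear_factor:
  "poly_act M ([:- \<mu>, 1:] * q) x = M *v poly_act M q x - \<mu> *s poly_act M q x"
proof -
  have "[:- \<mu>, 1:] * q = smult (- \<mu>) q + pCons 0 q" by simp
  then show ?thesis by (simp only: poly_act_add poly_act_smult poly_act_pCons) simp
qed

lemma poly_act_commute:
  "poly_act M q (M *v x - \<mu> *s x) = M *v poly_act M q x - \<mu> *s poly_act M q x"
proof (induction q)
  case 0
  then show ?case by (simp add: poly_act_def)
next
  case (pCons a p)
  show ?case
    unfolding poly_act_pCons pCons.IH
    by (simp add: algebra_simps vector_scalar_commute vec.scale_right_distrib vec.scale_right_diff_distrib mult.commute)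
qed

text \<open>A vector and its first \<open>CARD('n)\<close> images are one vector more than the dimension, hence (even if
some of them coincide) linearly dependent, and a dependence is an annihilating polynomial.\<close>
lemma orbit_annihilated:
  fixes M :: "complex^'n^'n"
  shows "\<exists>p. p \<noteq> 0 \<and> poly_act M p x = 0"
proof -
  let ?f = "\<lambda>i. ((*v) M ^^ i) x" and ?n = "CARD('n)"
  have "\<exists>c. (\<exists>i\<le>?n. c i \<noteq> 0) \<and> (\<Sum>i\<le>?n. c i *s ?f i) = 0"
  proof (cases "inj_on ?f {..?n}")
    case True
    then have "card (?f ` {..?n}) > ?n" by (simp add: card_image)
    then have "vec.dependent (?f ` {..?n})"
      using dim_subset_UNIV_cart_gen[of "?f ` {..?n}"]
      by (intro vec.dependent_biggerset_general) simp
    then obtain c where "\<exists>v\<in>?f ` {..?n}. c v \<noteq> 0" "(\<Sum>v\<in>?f ` {..?n}. c v *s v) = 0"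
      by (auto simp: vec.dependent_finite)
    then show ?thesis
      using True by (intro exI[of _ "c \<circ> ?f"]) (auto simp: sum.reindex)
  next
    case False
    then obtain i j where ij: "i \<le> ?n" "j \<le> ?n" "i \<noteq> j" "?f i = ?f j"
      by (auto simp: inj_on_def)
    let ?c = "\<lambda>k. if k = i then 1 else if k = j then - 1 else (0::complex)"
    have "(\<Sum>k\<le>?n. ?c k *s ?f k) = (\<Sum>k\<in>{i, j}. ?c k *s ?f k)"
      using ij by (intro sum.mono_neutral_right) auto
    also have "\<dots> = 0" using ij by simp
    finally show ?thesis using ij by (intro exI[of _ ?c]) auto
  qed
  then obtain c where c: "\<exists>i\<le>?n. c i \<noteq> 0" "(\<Sum>i\<le>?n. c i *s ?f i) = 0" by blast
  define p where "p = (\<Sum>i\<le>?n. monom (c i) i)"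
  have coeff: "coeff p i = c i" if "i \<le> ?n" for i
    using that by (simp add: p_def coeff_sum)
  have "degree p \<le> ?n"
    unfolding p_def by (intro degree_sum_le) (auto intro: order_trans[OF degree_monom_le])
  then have "poly_act M p x = 0"
    using c(2) by (simp add: poly_act_eq_sum coeff)
  moreover have "p \<noteq> 0" using c(1) coeff by (metis coeff_0)
  ultimately show ?thesis by blast
qed

text \<open>Convergence of the powers without a Jordan form, by induction on the degree of a polynomial
annihilating \<open>x\<close>. Split off a root \<open>\<mu>\<close>, leaving \<open>q\<close>. If \<open>\<bar>\<mu>\<bar> < 1\<close>, then \<open>q\<close> annihilates
\<open>y = M x - \<mu> x\<close>, so the orbit of \<open>y\<close> vanishes in the limit, and the orbit of \<open>x\<close> is a contraction
by \<open>\<mu>\<close> perturbed by it. Otherwise \<open>\<mu>\<close> is no eigenvalue; but \<open>q(M) x\<close> is mapped to its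
\<open>\<mu>\<close>-multiple, so it is zero, and \<open>q\<close> already annihilates \<open>x\<close>.\<close>
lemma orbit_tendsto_0_if_annihilated:
  fixes M :: "complex^'n^'n"
  assumes eig: "\<And>\<mu> v. v \<noteq> 0 \<Longrightarrow> M *v v = \<mu> *s v \<Longrightarrow> cmod \<mu> < 1"
    and "p \<noteq> 0" and "poly_act M p x = 0"
  shows "(\<lambda>k. ((*v) M ^^ k) x) \<longlonglongrightarrow> 0"
  using assms(2,3)
proof (induction "degree p" arbitrary: p x)
  case 0
  then obtain a where "p = [:a:]" by (metis degree_eq_zeroE)
  with 0 have "x = 0" by (simp add: poly_act_def)
  moreover have "((*v) M ^^ k) 0 = 0" for k by (induction k) auto
  ultimately show ?case by simp
next
  case (Suc d)
  then have "\<not> constant (poly p)" by (simp add: constant_degree)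
  then obtain \<mu> where "poly p \<mu> = 0" using fundamental_theorem_of_algebra by blast
  then obtain q where pq: "p = [:- \<mu>, 1:] * q" by (auto simp: poly_eq_0_iff_dvd dvd_def)
  with Suc have "q \<noteq> 0" by auto
  then have "degree p = Suc (degree q)"
    by (simp add: pq degree_mult_eq del: mult_pCons_left)
  with Suc have d: "d = degree q" by simp
  have fac: "M *v poly_act M q x - \<mu> *s poly_act M q x = 0"
    using poly_act_linear_factor[of M \<mu> q x] Suc.prems(2) by (simp only: pq)
  show ?case
  proof (cases "cmod \<mu> < 1")
    case True
    let ?y = "M *v x - \<mu> *s x"
    have "poly_act M q ?y = 0"
      using fac by (simp only: poly_act_commute)
    then have y: "(\<lambda>k. ((*v) M ^^ k) ?y) \<longlonglongrightarrow> 0"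
      using Suc.hyps(1)[OF d] \<open>q \<noteq> 0\<close> by blast
    have step: "((*v) M ^^ Suc k) x = \<mu> *s ((*v) M ^^ k) x + ((*v) M ^^ k) ?y" for k
    proof (induction k)
      case (Suc k)
      have "((*v) M ^^ Suc (Suc k)) x = M *v ((*v) M ^^ Suc k) x" by simp
      also have "\<dots> = M *v (\<mu> *s ((*v) M ^^ k) x + ((*v) M ^^ k) ?y)" by (simp only: Suc)
      finally show ?case by (simp add: algebra_simps vector_scalar_commute)
    qed simp
    show ?thesis
    proof (rule vec_tendstoI)
      fix i
      show "(\<lambda>k. ((*v) M ^^ k) x $ i) \<longlonglongrightarrow> 0 $ i"
        unfolding zero_index
      proof (rule perturbed_contraction_tendsto_0[OF _ True])
        show "((*v) M ^^ Suc k) x $ i = \<mu> * ((*v) M ^^ k) x $ i + ((*v) M ^^ k) ?y $ i" for k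
          unfolding step by simp
        show "(\<lambda>k. ((*v) M ^^ k) ?y $ i) \<longlonglongrightarrow> 0"
          using tendsto_vec_nth[OF y, of i] by simp
      qed
    qed
  next
    case False
    have "M *v poly_act M q x = \<mu> *s poly_act M q x"
      using fac by simp
    then have "poly_act M q x = 0" using eig False by blast
    then show ?thesis using Suc.hyps(1)[OF d] \<open>q \<noteq> 0\<close> by blast
  qed
qed

definition cvec :: "real^'n \<Rightarrow> complex^'n" where
  "cvec x = (\<chi> i. complex_of_real (x $ i))"

lemma schur_stable_matpow_tendsto_0:
  fixes M :: "real^'n^'n"
  assumes "schur_stable M"
  shows "(\<lambda>k. matpow M k *v x) \<longlonglongrightarrow> 0"
proof (rule vec_tendstoI)
  fix i
  let ?M = "\<chi> i j. complex_of_real (M $ i $ j)"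
  have mult: "?M *v cvec z = cvec (M *v z)" for z
    by (simp add: cvec_def matrix_vector_mult_def vec_eq_iff)
  have pow: "((*v) ?M ^^ k) (cvec x) = cvec (matpow M k *v x)" for k
    by (induction k) (simp_all add: mult matrix_vector_mul_assoc)
  obtain p where "p \<noteq> 0" "poly_act ?M p (cvec x) = 0" using orbit_annihilated by blast
  then have "(\<lambda>k. ((*v) ?M ^^ k) (cvec x)) \<longlonglongrightarrow> 0"
    by (rule orbit_tendsto_0_if_annihilated[rotated]) (use assms in \<open>unfold schur_stable_def, blast\<close>)
  then have "(\<lambda>k. cvec (matpow M k *v x)) \<longlonglongrightarrow> 0" by (simp only: pow)
  from tendsto_vec_nth[OF this, of i]
  have "(\<lambda>k. complex_of_real ((matpow M k *v x) $ i)) \<longlonglongrightarrow> 0" by (simp add: cvec_def)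
  then show "(\<lambda>k. (matpow M k *v x) $ i) \<longlonglongrightarrow> 0 $ i"
    using tendsto_of_real_iff[of "\<lambda>k. (matpow M k *v x) $ i" 0 sequentially, where ?'a = complex] by simp
qed

text \<open>The eigenvector equation for \<open>\<mu> = a + i b\<close> and \<open>v = x + i y\<close>, split into real and imaginary parts.
In this form stability can be tested with real quadratic forms.\<close>
lemma schur_stable_iff_real:
  fixes M :: "real^'n^'n"
  shows "schur_stable M \<longleftrightarrow>
    (\<forall>a b x y. (x \<noteq> 0 \<or> y \<noteq> 0) \<and> M *v x = a *\<^sub>R x - b *\<^sub>R y \<and> M *v y = b *\<^sub>R x + a *\<^sub>R y
       \<longrightarrow> a\<^sup>2 + b\<^sup>2 < 1)"
proof -
  let ?M = "\<chi> i j. complex_of_real (M $ i $ j)"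
  define pair where "pair = (\<lambda>x y :: real^'n. (\<chi> i. Complex (x $ i) (y $ i)))"
  have surj: "\<exists>x y. v = pair x y" for v
    by (rule exI[of _ "\<chi> i. Re (v $ i)"], rule exI[of _ "\<chi> i. Im (v $ i)"])
       (simp add: pair_def vec_eq_iff)
  have zero: "pair x y = 0 \<longleftrightarrow> x = 0 \<and> y = 0" for x y
    by (auto simp: pair_def vec_eq_iff complex_eq_iff)
  have eig: "?M *v pair x y = Complex a b *s pair x y \<longleftrightarrow>
      M *v x = a *\<^sub>R x - b *\<^sub>R y \<and> M *v y = b *\<^sub>R x + a *\<^sub>R y" for a b x y
    by (auto simp: pair_def vec_eq_iff complex_eq_iff matrix_vector_mult_def Re_sum Im_sum)
  have cm: "cmod (Complex a b) < 1 \<longleftrightarrow> a\<^sup>2 + b\<^sup>2 < 1" for a b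
    by (simp add: cmod_def)
  show ?thesis
  proof (intro iffI allI impI)
    fix a b x y
    assume "schur_stable M"
      and "(x \<noteq> 0 \<or> y \<noteq> 0) \<and> M *v x = a *\<^sub>R x - b *\<^sub>R y \<and> M *v y = b *\<^sub>R x + a *\<^sub>R y"
    then have "cmod (Complex a b) < 1"
      using zero eig unfolding schur_stable_def by blast
    then show "a\<^sup>2 + b\<^sup>2 < 1" by (simp only: cm)
  next
    assume real: "\<forall>a b x y. (x \<noteq> 0 \<or> y \<noteq> 0) \<and> M *v x = a *\<^sub>R x - b *\<^sub>R y \<and>
        M *v y = b *\<^sub>R x + a *\<^sub>R y \<longrightarrow> a\<^sup>2 + b\<^sup>2 < 1"
    show "schur_stable M"
      unfolding schur_stable_def
    proof (intro allI impI)
      fix \<mu> v assume v: "v \<noteq> 0 \<and> ?M *v v = \<mu> *s v"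
      obtain a b where \<mu>: "\<mu> = Complex a b" by (cases \<mu>)
      obtain x y where xy: "v = pair x y" using surj by blast
      from v have "(x \<noteq> 0 \<or> y \<noteq> 0) \<and> M *v x = a *\<^sub>R x - b *\<^sub>R y \<and> M *v y = b *\<^sub>R x + a *\<^sub>R y"
        unfolding \<mu> xy zero eig by blast
      with real have "a\<^sup>2 + b\<^sup>2 < 1" by (elim allE) (erule mp)
      then show "cmod \<mu> < 1" by (simp only: \<mu> cm)
    qed
  qed
qed

section \<open>Quadratic forms and the Loewner order\<close>

lemma transpose_add: "transpose (M + N) = transpose M + transpose (N :: real^'n^'m)"
  by (simp add: transpose_def vec_eq_iff)

lemma transpose_diff: "transpose (M - N) = transpose M - transpose (N :: real^'n^'m)"
  by (simp add: transpose_def vec_eq_iff)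

lemma matrix_vector_mult_minus_left: "(- M) *v x = - (M *v (x :: real^'n))"
  by (simp add: matrix_vector_mult_def vec_eq_iff sum_negf)

lemma matrix_vector_mult_minus_right: "M *v (- x) = - (M *v (x :: real^'n))"
  by (simp add: matrix_vector_mult_def vec_eq_iff sum_negf)

definition qform :: "real^'n^'n \<Rightarrow> real^'n \<Rightarrow> real" where
  "qform M x = x \<bullet> (M *v x)"

lemma qform_0 [simp]: "qform M 0 = 0" "qform 0 x = 0"
  by (simp_all add: qform_def)

lemma qform_add: "qform (M + N) x = qform M x + qform N x"
  by (simp add: qform_def matrix_vector_mult_add_rdistrib inner_add_right)

lemma qform_diff: "qform (M - N) x = qform M x - qform N x"
  by (simp add: qform_def matrix_vector_mult_diff_rdistrib inner_diff_right)

lemma qform_scaleR: "qform (c *\<^sub>R M) x = c * qform M x"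
  by (simp add: qform_def flip: scaleR_matrix_vector_assoc)

lemma inner_transpose_mult:
  "x \<bullet> (transpose G *v z) = (G *v x) \<bullet> (z :: real^'n)"
  by (metis dot_lmul_matrix inner_commute transpose_matrix_vector)

lemma inner_congruence:
  "x \<bullet> ((transpose G ** M ** H) *v y) = (G *v x) \<bullet> (M *v (H *v (y :: real^'n)))"
  by (simp only: matrix_vector_mul_assoc[symmetric] inner_transpose_mult)

lemma qform_congruence: "qform (transpose G ** M ** G) x = qform M (G *v x)"
  unfolding qform_def by (rule inner_congruence)

lemma sym_mat_inner: "sym_mat M \<Longrightarrow> x \<bullet> (M *v y) = y \<bullet> (M *v x)"
  by (metis dot_lmul_matrix inner_commute sym_mat_def transpose_matrix_vector)

lemma qform_plus:
  assumes "sym_mat M"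
  shows "qform M (x + y) = qform M x + 2 * (y \<bullet> (M *v x)) + qform M y"
  using sym_mat_inner[OF assms, of x y]
  by (simp add: qform_def matrix_vector_right_distrib inner_add_left inner_add_right)

lemma qform_scaleR_vec: "qform M (c *\<^sub>R x) = c\<^sup>2 * qform M x"
  by (simp add: qform_def matrix_vector_mult_scaleR power2_eq_square)

lemma sym_mat_add: "sym_mat M \<Longrightarrow> sym_mat N \<Longrightarrow> sym_mat (M + N)"
  by (simp add: sym_mat_def transpose_add)

lemma sym_mat_diff: "sym_mat M \<Longrightarrow> sym_mat N \<Longrightarrow> sym_mat (M - N)"
  by (simp add: sym_mat_def transpose_diff)

lemma sym_mat_scaleR: "sym_mat M \<Longrightarrow> sym_mat (c *\<^sub>R M)"
  by (simp add: sym_mat_def transpose_scalar)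

lemma sym_mat_congruence: "sym_mat M \<Longrightarrow> sym_mat (transpose G ** M ** G)"
  by (simp add: sym_mat_def matrix_transpose_mul matrix_mul_assoc)

lemma psd_iff_qform: "psd M \<longleftrightarrow> sym_mat M \<and> (\<forall>x. 0 \<le> qform M x)"
  by (simp add: psd_def qform_def)

lemma loewner_le_iff_qform:
  assumes "sym_mat M" "sym_mat N"
  shows "M \<preceq> N \<longleftrightarrow> (\<forall>x. qform M x \<le> qform N x)"
  using assms by (simp add: loewner_le_def psd_iff_qform sym_mat_diff qform_diff)

lemma pos_def_matrix_inv_right:
  assumes "pos_def S"
  shows "S ** matrix_inv S = mat 1"
proof -
  have "\<forall>x. S *v x = 0 \<longrightarrow> x = 0"
    using assms unfolding pos_def_def by (metis inner_zero_right less_irrefl)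
  then have "invertible S"
    by (simp add: invertible_left_inverse matrix_left_invertible_ker)
  then show ?thesis 
    unfolding invertible_def matrix_inv_def by (rule someI2_ex) simp
qed

section \<open>Block matrices\<close>

text \<open>The stacked vector of a state and an input, matching the partition of \<open>block_mat\<close>.\<close>

definition join :: "real^'n \<Rightarrow> real^'m \<Rightarrow> real^('n::finite + 'm::finite)" where
  "join y u = (\<chi> i. case i of Inl a \<Rightarrow> y $ a | Inr b \<Rightarrow> u $ b)"

lemma join_cases: obtains y u where "w = join y u"
proof
  show "w = join (\<chi> a. w $ Inl a) (\<chi> b. w $ Inr b)"
    by (simp add: join_def vec_eq_iff split: sum.split)
qed

lemma join_eq_iff [simp]: "join y u = join y' u' \<longleftrightarrow> y = y' \<and> u = u'"
  by (auto simp: join_def vec_eq_iff split_sum_all)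

lemma join_0 [simp]: "join 0 0 = 0"
  by (simp add: join_def vec_eq_iff split: sum.split)

lemma join_add: "join y u + join y' u' = join (y + y') (u + u')"
  by (simp add: join_def vec_eq_iff split: sum.split)

lemma join_diff: "join y u - join y' u' = join (y - y') (u - u')"
  by (simp add: join_def vec_eq_iff split: sum.split)

lemma join_scaleR: "c *\<^sub>R join y u = join (c *\<^sub>R y) (c *\<^sub>R u)"
  by (simp add: join_def vec_eq_iff split: sum.split)

lemma sum_UNIV_sum_type:
  "(\<Sum>i\<in>UNIV. f i) = (\<Sum>a\<in>UNIV. f (Inl a)) + (\<Sum>b\<in>UNIV. f (Inr b :: 'n::finite + 'm::finite))"
  by (simp add: sum.Plus flip: UNIV_Plus_UNIV)

lemma inner_join: "join y u \<bullet> join y' u' = y \<bullet> y' + u \<bullet> u'"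
  by (simp add: join_def inner_vec_def sum_UNIV_sum_type)

lemma block_mat_mult_join:
  "block_mat M11 M12 M21 M22 *v join y u = join (M11 *v y + M12 *v u) (M21 *v y + M22 *v u)"
  by (simp add: block_mat_def join_def vec_eq_iff matrix_vector_mult_def sum_UNIV_sum_type
      split: sum.split)

lemma aug_mat_mult_join:
  "aug_mat A B F *v join y u = join (A *v y + B *v u) (F *v (A *v y + B *v u))"
  by (simp add: aug_mat_def block_mat_mult_join matrix_vector_mul_assoc
      matrix_vector_right_distrib)

text \<open>For a symmetric matrix the lower left block is the transpose of \<open>block12\<close>, so that its action on
stacked vectors can be read off from \<open>block_mat_mult_join\<close>.\<close>
lemma block_mat_blocks:
  assumes "sym_mat P"
  shows "P = block_mat (\<chi> i j. P $ Inl i $ Inl j) (block12 P) (transpose (block12 P)) (block22 P)"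
proof -
  have "transpose P $ Inl j $ Inr i = P $ Inl j $ Inr i" for i j
    using assms by (simp only: sym_mat_def)
  then have "P $ Inr i $ Inl j = P $ Inl j $ Inr i" for i j
    by (simp add: transpose_def)
  then show ?thesis
    by (simp add: block_mat_def block12_def block22_def transpose_def vec_eq_iff split: sum.split)
qed

lemma qform_cost_mat: "qform (cost_mat Q R) (join y u) = qform Q y + qform R u"
  by (simp add: cost_mat_def qform_def block_mat_mult_join inner_join)

lemma transpose_block_mat:
  "transpose (block_mat M11 M12 M21 M22) =
    block_mat (transpose M11) (transpose M21) (transpose M12) (transpose M22)"
  by (simp add: block_mat_def transpose_def vec_eq_iff split: sum.split)

lemma transpose_0: "transpose (0 :: real^'n^'m) = 0"
  by (simp add: transpose_def vec_eq_iff)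

lemma sym_cost_mat:
  assumes "sym_mat Q" "sym_mat R"
  shows "sym_mat (cost_mat Q R)"
  using assms by (simp add: sym_mat_def cost_mat_def transpose_block_mat transpose_0)

lemma qform_block22: "qform (block22 P) u = qform P (join 0 u)"
  by (simp add: qform_def inner_vec_def join_def block22_def matrix_vector_mult_def sum_UNIV_sum_type)

lemma sym_block22: "sym_mat P \<Longrightarrow> sym_mat (block22 P)"
  by (simp add: sym_mat_def block22_def transpose_def vec_eq_iff)

section \<open>The Bellman operator as a minimum over gains\<close>

lemma bellman_dom_mono:
  assumes "P' \<in> bellman_dom" "sym_mat P" "P' \<preceq> P"
  shows "P \<in> bellman_dom"
proof -
  have P': "psd P'" "pos_def (block22 P')" using assms(1) by (auto simp: bellman_dom_def)
  then have le: "qform P' x \<le> qform P x" for x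
    using assms by (simp add: loewner_le_iff_qform psd_def)
  have "psd P" using P'(1) assms(2) le by (meson order_trans psd_iff_qform)
  moreover have "pos_def (block22 P)"
    using P'(2) le assms(2) sym_block22
    unfolding pos_def_def qform_def[symmetric] qform_block22 by (metis less_le_trans)
  ultimately show ?thesis by (simp add: bellman_dom_def)
qed

text \<open>The greedy input is the critical point of the quadratic form in its second argument: half the
gradient there, the lower block row of \<open>P\<close> applied to the stacked vector, vanishes.\<close>
lemma greedy_gain_stationary:
  assumes "pos_def (block22 P)"
  shows "transpose (block12 P) *v y + block22 P *v (greedy_gain P *v y) = 0"
proof -
  have "block22 P *v (greedy_gain P *v y) =
      - ((block22 P ** matrix_inv (block22 P)) *v (transpose (block12 P) *v y))"
    by (simp add: greedy_gain_def matrix_vector_mult_minus_left matrix_vector_mul_assoc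
        matrix_mul_assoc matrix_vector_mult_minus_right del: transpose_matrix_vector)
  also have "\<dots> = - (transpose (block12 P) *v y)"
    using assms by (simp add: pos_def_matrix_inv_right)
  finally show ?thesis by simp
qed

text \<open>Completion of squares: moving from the greedy input to \<open>u\<close> changes the form by a cross term, zero by
stationarity, and by the value of the form at \<open>(0, u - greedy)\<close>, which is nonnegative.\<close>
lemma greedy_gain_minimizes:
  assumes "P \<in> bellman_dom"
  shows "qform P (join y (greedy_gain P *v y)) \<le> qform P (join y u)"
proof -
  have P: "psd P" "pos_def (block22 P)" using assms by (auto simp: bellman_dom_def)
  then have sym: "sym_mat P" by (simp add: psd_def)
  let ?g = "greedy_gain P *v y"
  have "join 0 (u - ?g) \<bullet> (P *v join y ?g) = 0"
    by (subst block_mat_blocks[OF sym])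
       (simp add: block_mat_mult_join inner_join greedy_gain_stationary P(2)
         del: transpose_matrix_vector)
  then have "qform P (join y ?g + join 0 (u - ?g)) = qform P (join y ?g) + qform P (join 0 (u - ?g))"
    by (simp add: qform_plus[OF sym])
  moreover have "0 \<le> qform P (join 0 (u - ?g))" using P(1) by (simp add: psd_iff_qform)
  ultimately show ?thesis by (simp add: join_add)
qed

lemma greedy_gain_minimizes_aug:
  assumes "P \<in> bellman_dom"
  shows "qform P (aug_mat A B (greedy_gain P) *v w) \<le> qform P (aug_mat A B F *v w)"
  by (cases w rule: join_cases) (simp add: aug_mat_mult_join greedy_gain_minimizes[OF assms])

lemma qform_bellman:
  assumes "P \<in> bellman_dom"
  shows "qform (bellman A B \<gamma> Q R P) w =
    qform (cost_mat Q R) w + \<gamma> * qform P (aug_mat A B (greedy_gain P) *v w)"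
  using assms by (simp only: bellman_def if_True qform_add qform_scaleR qform_congruence)

text \<open>The Bellman operator is the pointwise minimum of the policy evaluation operators, so that every
gain \<open>F\<close> yields an upper bound. Applied with the optimal gain, this gives the rate in the theorem.\<close>
lemma qform_bellman_le:
  assumes "P \<in> bellman_dom" "0 \<le> \<gamma>"
  shows "qform (bellman A B \<gamma> Q R P) w \<le> qform (cost_mat Q R) w + \<gamma> * qform P (aug_mat A B F *v w)"
  unfolding qform_bellman[OF assms(1)]
  by (intro add_left_mono mult_left_mono greedy_gain_minimizes_aug assms)

lemma sym_bellman:
  assumes "P \<in> bellman_dom" "sym_mat Q" "sym_mat R"
  shows "sym_mat (bellman A B \<gamma> Q R P)"
proof -
  have "sym_mat P" using assms(1) by (simp add: bellman_dom_def psd_def)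
  then show ?thesis
    using assms by (simp only: bellman_def if_True sym_mat_add sym_cost_mat sym_mat_scaleR sym_mat_congruence)
qed

section \<open>The Q-matrix of a Riccati solution is a fixed point\<close>

text \<open>The Q-function: stage cost of \<open>(y, u)\<close> plus the discounted value of the successor state.\<close>

lemma qform_riccati_Qmat:
  assumes "sym_mat X"
  shows "qform (riccati_Qmat A B \<gamma> Q R X) (join y u) =
    qform Q y + qform R u + \<gamma> * qform X (A *v y + B *v u)"
proof -
  have "qform (riccati_Qmat A B \<gamma> Q R X) (join y u) =
      qform Q y + qform R u + \<gamma> * (qform X (A *v y) + (A *v y) \<bullet> (X *v (B *v u))
        + (B *v u) \<bullet> (X *v (A *v y)) + qform X (B *v u))"
    unfolding riccati_Qmat_def qform_def block_mat_mult_join inner_join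
      matrix_vector_mult_add_rdistrib inner_add_right scaleR_matrix_vector_assoc[symmetric]
      inner_scaleR_right inner_congruence
    by (simp only: distrib_left add.assoc add.left_commute add.commute)
  then show ?thesis
    using sym_mat_inner[OF assms, of "A *v y" "B *v u"] by (simp add: qform_plus[OF assms])
qed

lemma block_riccati_Qmat:
  shows "block22 (riccati_Qmat A B \<gamma> Q R X) = R + \<gamma> *\<^sub>R (transpose B ** X ** B)"
    and "block12 (riccati_Qmat A B \<gamma> Q R X) = \<gamma> *\<^sub>R (transpose A ** X ** B)"
  by (simp_all add: riccati_Qmat_def block_mat_def block22_def block12_def vec_eq_iff)

lemma greedy_gain_riccati_Qmat:
  assumes "sym_mat X"
  shows "greedy_gain (riccati_Qmat A B \<gamma> Q R X) = riccati_gain A B \<gamma> R X"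
  using assms by (simp add: greedy_gain_def riccati_gain_def block_riccati_Qmat sym_mat_def
      transpose_scalar matrix_transpose_mul matrix_mul_assoc)

lemma sym_riccati_Qmat:
  assumes "sym_mat X" "sym_mat Q" "sym_mat R"
  shows "sym_mat (riccati_Qmat A B \<gamma> Q R X)"
  using assms by (simp add: sym_mat_def riccati_Qmat_def transpose_block_mat transpose_add
      transpose_scalar matrix_transpose_mul matrix_mul_assoc)

lemma riccati_Qmat_in_bellman_dom:
  assumes "0 \<le> \<gamma>" "psd Q" "pos_def R" "psd X"
  shows "riccati_Qmat A B \<gamma> Q R X \<in> bellman_dom" (is "?P \<in> _")
proof -
  have sym: "sym_mat X" "sym_mat Q" "sym_mat R" using assms by (auto simp: psd_def pos_def_def)
  have nonneg: "0 \<le> qform Q y" "0 \<le> \<gamma> * qform X y" for y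
    using assms by (simp_all add: psd_iff_qform)
  have R: "u \<noteq> 0 \<Longrightarrow> 0 < qform R u" for u using assms(3) by (simp add: pos_def_def qform_def)
  have symP: "sym_mat ?P" using sym by (simp add: sym_riccati_Qmat)
  have "0 \<le> qform R u" for u using R[of u] by (cases "u = 0") auto
  then have "0 \<le> qform ?P w" for w
    by (cases w rule: join_cases) (simp add: qform_riccati_Qmat[OF sym(1)] nonneg)
  moreover have "0 < qform (block22 ?P) u" if "u \<noteq> 0" for u
    using nonneg(2)[of "B *v u"] R[OF that] by (simp add: qform_block22 qform_riccati_Qmat[OF sym(1)])
  ultimately show ?thesis
    using symP sym_block22[OF symP] by (simp add: bellman_dom_def psd_iff_qform pos_def_def flip: qform_def)
qed

text \<open>The Riccati equation says that using the Riccati gain now returns the value \<open>X\<close>: that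
gain is greedy, so the lower block contributes nothing, and the upper block is the right-hand side
of the equation.\<close>
lemma qform_riccati_Qmat_gain:
  assumes "sym_mat X" "pos_def (R + \<gamma> *\<^sub>R (transpose B ** X ** B))"
    and "riccati_solution A B \<gamma> Q R X"
  shows "qform (riccati_Qmat A B \<gamma> Q R X) (join z (riccati_gain A B \<gamma> R X *v z)) = qform X z"
proof -
  let ?P = "riccati_Qmat A B \<gamma> Q R X" and ?u = "riccati_gain A B \<gamma> R X *v z"
  let ?H = "\<gamma> *\<^sub>R (transpose B ** X ** A)"
  have H: "transpose (block12 ?P) = ?H"
    using assms(1) by (simp add: block_riccati_Qmat sym_mat_def transpose_scalar
        matrix_transpose_mul matrix_mul_assoc)
  have stat: "?H *v z + (R + \<gamma> *\<^sub>R (transpose B ** X ** B)) *v ?u = 0"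
    using greedy_gain_stationary[of ?P z] assms(2)
    unfolding greedy_gain_riccati_Qmat[OF assms(1)] H block_riccati_Qmat(1) by simp
  have "X *v z = (Q + \<gamma> *\<^sub>R (transpose A ** X ** A)) *v z + (\<gamma> *\<^sub>R (transpose A ** X ** B)) *v ?u"
    by (subst assms(3)[unfolded riccati_solution_def])
       (simp add: riccati_gain_def matrix_vector_mult_add_rdistrib matrix_vector_mult_diff_rdistrib
         matrix_vector_mult_minus_left matrix_vector_mult_minus_right
         matrix_vector_mul_assoc matrix_mul_assoc)
  then show ?thesis
    unfolding qform_def riccati_Qmat_def block_mat_mult_join inner_join stat by simp
qed

text \<open>The range of \<open>aug_mat A B F\<close> consists of the stacked vectors \<open>(z, F z)\<close> with \<open>z\<close> the successor
state, and on these the Q-function is the value function.\<close>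
lemma qform_riccati_Qmat_fixpoint:
  assumes "sym_mat X" "pos_def (R + \<gamma> *\<^sub>R (transpose B ** X ** B))"
    and "riccati_solution A B \<gamma> Q R X"
  shows "qform (riccati_Qmat A B \<gamma> Q R X) w = qform (cost_mat Q R) w
    + \<gamma> * qform (riccati_Qmat A B \<gamma> Q R X) (aug_mat A B (riccati_gain A B \<gamma> R X) *v w)"
proof (cases w rule: join_cases)
  fix y u assume "w = join y u"
  then show ?thesis
    by (simp only: aug_mat_mult_join qform_riccati_Qmat_gain[OF assms] qform_cost_mat
        qform_riccati_Qmat[OF assms(1), of _ _ _ _ _ y u])
qed

section \<open>Stability of the optimal closed loop\<close>

text \<open>Summed over the real and imaginary parts of a vector, a quadratic form scales by \<open>\<bar>\<mu>\<bar>\<^sup>2\<close> under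
  multiplication by \<open>\<mu> = a + i b\<close>.\<close>

lemma qform_rotate:
  assumes "sym_mat M"
  shows "qform M (a *\<^sub>R x - b *\<^sub>R y) + qform M (b *\<^sub>R x + a *\<^sub>R y) =
    (a\<^sup>2 + b\<^sup>2) * (qform M x + qform M y)"
  using sym_mat_inner[OF assms, of x y]
  by (simp add: qform_def matrix_vector_right_distrib matrix_vector_mult_diff_distrib
      matrix_vector_mult_scaleR inner_add_left inner_add_right inner_diff_left inner_diff_right
      power2_eq_square algebra_simps)

text \<open>The fixed point equation is a Lyapunov equation with right-hand side \<open>cost_mat\<close>. An eigenvector for an
eigenvalue \<open>\<bar>\<mu>\<bar> \<ge> 1\<close> would have to incur no cost: its input part is zero because \<open>R\<close> is positive
definite, and its state part is invisible to \<open>C\<close>. The state part is then an eigenvector of \<open>A\<close>, and of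
\<open>A + L C\<close> for every \<open>L\<close>, for the eigenvalue \<open>\<mu> / \<surd>\<gamma>\<close> of modulus at least one,
which detectability excludes. The bound \<open>\<gamma> \<le> 1\<close> enters in this last step.\<close>
lemma schur_stable_closed_loop:
  fixes A :: "real^'n^'n" and B :: "real^'m^'n" and C :: "real^'n^'p"
  assumes \<gamma>: "0 < \<gamma>" "\<gamma> \<le> 1" and R: "pos_def R"
    and det: "detectable A C" and P: "psd P"
    and lyap: "\<And>w. qform P w =
      qform (cost_mat (transpose C ** C) R) w + \<gamma> * qform P (aug_mat A B F *v w)"
  shows "schur_stable (sqrt \<gamma> *\<^sub>R aug_mat A B F)"
  unfolding schur_stable_iff_real
proof (intro allI impI, elim conjE)
  fix a b x y
  let ?M = "sqrt \<gamma> *\<^sub>R aug_mat A B F" and ?\<Lambda> = "cost_mat (transpose C ** C) R"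
  assume nz: "x \<noteq> 0 \<or> y \<noteq> 0"
    and eig: "?M *v x = a *\<^sub>R x - b *\<^sub>R y" "?M *v y = b *\<^sub>R x + a *\<^sub>R y"
  obtain x1 x2 where x: "x = join x1 x2" by (rule join_cases)
  obtain y1 y2 where y: "y = join y1 y2" by (rule join_cases)
  have cost: "qform ?\<Lambda> (join z u) = (norm (C *v z))\<^sup>2 + qform R u" for z u
    using qform_congruence[of C "mat 1" z]
    by (simp add: qform_cost_mat) (simp add: qform_def power2_norm_eq_inner)
  have R_nonneg: "0 \<le> qform R u" and R_zero: "qform R u = 0 \<Longrightarrow> u = 0" for u
    using R by (cases "u = 0"; force simp: pos_def_def qform_def)+
  show "a\<^sup>2 + b\<^sup>2 < 1"
  proof (rule ccontr)
    assume "\<not> a\<^sup>2 + b\<^sup>2 < 1"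
    have scale: "\<gamma> * qform P (aug_mat A B F *v w) = qform P (?M *v w)" for w
      using \<gamma>(1) by (simp add: qform_scaleR_vec flip: scaleR_matrix_vector_assoc)
    have "qform ?\<Lambda> x + qform ?\<Lambda> y = (1 - (a\<^sup>2 + b\<^sup>2)) * (qform P x + qform P y)"
      using lyap[of x] lyap[of y] qform_rotate[of P a x b y] P
      unfolding scale eig by (simp add: psd_def left_diff_distrib)
    also have "\<dots> \<le> 0"
      using P \<open>\<not> a\<^sup>2 + b\<^sup>2 < 1\<close> by (intro mult_nonpos_nonneg) (auto simp: psd_iff_qform)
    finally have "qform ?\<Lambda> x + qform ?\<Lambda> y \<le> 0" .
    then have "(norm (C *v x1))\<^sup>2 + qform R x2 + ((norm (C *v y1))\<^sup>2 + qform R y2) \<le> 0"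
      by (simp only: x y cost)
    then have "(norm (C *v x1))\<^sup>2 = 0" "(norm (C *v y1))\<^sup>2 = 0" "qform R x2 = 0" "qform R y2 = 0"
      using R_nonneg[of x2] R_nonneg[of y2] zero_le_power2[of "norm (C *v x1)"]
        zero_le_power2[of "norm (C *v y1)"] by linarith+
    then have C: "C *v x1 = 0" "C *v y1 = 0" and zero: "x2 = 0" "y2 = 0"
      using R_zero by simp_all
    obtain L where L: "schur_stable (A + L ** C)" using det by (auto simp: detectable_def)
    have "sqrt \<gamma> *\<^sub>R (A *v x1) = a *\<^sub>R x1 - b *\<^sub>R y1" "sqrt \<gamma> *\<^sub>R (A *v y1) = b *\<^sub>R x1 + a *\<^sub>R y1"
      using eig by (simp_all add: x y zero aug_mat_mult_join join_scaleR join_diff join_add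
          flip: scaleR_matrix_vector_assoc)
    then have A: "A *v x1 = inverse (sqrt \<gamma>) *\<^sub>R (a *\<^sub>R x1 - b *\<^sub>R y1)"
        "A *v y1 = inverse (sqrt \<gamma>) *\<^sub>R (b *\<^sub>R x1 + a *\<^sub>R y1)"
      using \<gamma>(1) by (simp_all flip: \<open>sqrt \<gamma> *\<^sub>R (A *v x1) = _\<close> \<open>sqrt \<gamma> *\<^sub>R (A *v y1) = _\<close>)
    have "(A + L ** C) *v x1 = (a / sqrt \<gamma>) *\<^sub>R x1 - (b / sqrt \<gamma>) *\<^sub>R y1"
      "(A + L ** C) *v y1 = (b / sqrt \<gamma>) *\<^sub>R x1 + (a / sqrt \<gamma>) *\<^sub>R y1"
      by (simp_all add: matrix_vector_mult_add_rdistrib A C scaleR_diff_right scaleR_add_right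
          divide_inverse mult.commute flip: matrix_vector_mul_assoc)
    moreover have "x1 \<noteq> 0 \<or> y1 \<noteq> 0" using nz by (auto simp: x y zero)
    ultimately have "(a / sqrt \<gamma>)\<^sup>2 + (b / sqrt \<gamma>)\<^sup>2 < 1"
      using L unfolding schur_stable_iff_real by blast
    then have "a\<^sup>2 + b\<^sup>2 < \<gamma>"
      using \<gamma>(1) by (simp add: power_divide flip: add_divide_distrib)
    with \<gamma>(2) \<open>\<not> a\<^sup>2 + b\<^sup>2 < 1\<close> show False by linarith
  qed
qed

section \<open>Decay of discounted congruences\<close>

lemma matpow_Suc_right: "matpow M (Suc k) = matpow M k ** M"
  by (induction k) (simp_all add: matrix_mul_assoc)

lemma transpose_matpow: "matpow (transpose M) k = transpose (matpow M k)"
proof (induction k)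
  case (Suc k)
  have "matpow (transpose M) (Suc k) = transpose M ** transpose (matpow M k)"
    by (simp add: Suc)
  also have "\<dots> = transpose (matpow M (Suc k))"
    by (simp only: matpow_Suc_right matrix_transpose_mul)
  finally show ?case .
qed simp

lemma matpow_scaleR: "matpow (c *\<^sub>R M) k = c ^ k *\<^sub>R matpow M k"
  by (induction k) (simp_all add: matrix_scalar_ac mult.commute flip: scalar_matrix_assoc)

lemma matrix_tendsto_0I:
  fixes N :: "nat \<Rightarrow> real^'n^'m"
  assumes "\<And>x y. (\<lambda>k. x \<bullet> (N k *v y)) \<longlonglongrightarrow> 0"
  shows "N \<longlonglongrightarrow> 0"
proof (intro vec_tendstoI)
  fix i j
  show "(\<lambda>k. N k $ i $ j) \<longlonglongrightarrow> 0 $ i $ j"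
    using assms[of "axis i 1" "axis j 1"]
    by (simp add: inner_axis' matrix_vector_mult_basis column_def)
qed

text \<open>Splitting \<open>\<gamma>\<close> into two square roots, one for each factor, turns the bilinear form into one evaluated
at powers of a stable matrix.\<close>
lemma discounted_congruence_tendsto_0:
  fixes M D :: "real^'n^'n"
  assumes "0 \<le> \<gamma>" and "schur_stable (sqrt \<gamma> *\<^sub>R M)"
  shows "(\<lambda>k. \<gamma> ^ k *\<^sub>R (matpow (transpose M) k ** D ** matpow M k)) \<longlonglongrightarrow> 0"
proof (rule matrix_tendsto_0I)
  fix x y
  let ?N = "\<lambda>k. matpow (sqrt \<gamma> *\<^sub>R M) k"
  have "x \<bullet> ((\<gamma> ^ k *\<^sub>R (matpow (transpose M) k ** D ** matpow M k)) *v y) =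
      (?N k *v x) \<bullet> (D *v (?N k *v y))" for k
  proof -
    have "\<gamma> ^ k = sqrt \<gamma> ^ k * sqrt \<gamma> ^ k"
      using assms(1) by (simp flip: power_mult_distrib)
    then show ?thesis
      by (simp add: transpose_matpow inner_congruence matpow_scaleR matrix_vector_mult_scaleR
          flip: scaleR_matrix_vector_assoc)
  qed
  moreover have "(\<lambda>k. (?N k *v x) \<bullet> (D *v (?N k *v y))) \<longlonglongrightarrow> 0 \<bullet> (D *v 0)"
    by (intro tendsto_inner bounded_linear.tendsto[OF matrix_vector_mul_bounded_linear]
        schur_stable_matpow_tendsto_0 assms)
  ultimately show "(\<lambda>k. x \<bullet> ((\<gamma> ^ k *\<^sub>R (matpow (transpose M) k ** D ** matpow M k)) *v y)) \<longlonglongrightarrow> 0"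
    by simp
qed

section \<open>Convergence of value iteration\<close>

theorem theorem2:
  fixes A :: "real^'n^'n" and B :: "real^'m^'n" and C :: "real^'n^'p"
    and Q :: "real^'n^'n" and R :: "real^'m^'m" and \<gamma> :: real
    and Xstar :: "real^'n^'n" and Fstar :: "real^'n^'m"
    and Pstar P :: "real^('n + 'm)^('n + 'm)"
  assumes "0 < \<gamma>" and "\<gamma> \<le> 1"
    and "psd Q" and "pos_def R"
    and "stabilizable A B"
    and "Q = transpose C ** C" and "detectable A C"
    and "psd Xstar" and "riccati_solution A B \<gamma> Q R Xstar"
    and "Fstar = riccati_gain A B \<gamma> R Xstar"
    and "Pstar = riccati_Qmat A B \<gamma> Q R Xstar"
    and "sym_mat P" and "Pstar \<preceq> P"
  shows "(\<forall>k::nat.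
            0 \<preceq> (bellman A B \<gamma> Q R ^^ k) P - Pstar \<and>
            (bellman A B \<gamma> Q R ^^ k) P - Pstar \<preceq>
              \<gamma> ^ k *\<^sub>R (matpow (transpose (aug_mat A B Fstar)) k ** (P - Pstar)
                        ** matpow (aug_mat A B Fstar) k)) \<and>
         (\<lambda>k. \<gamma> ^ k *\<^sub>R (matpow (transpose (aug_mat A B Fstar)) k ** (P - Pstar)
                        ** matpow (aug_mat A B Fstar) k)) \<longlonglongrightarrow> 0"
proof -
  let ?T = "bellman A B \<gamma> Q R" and ?F = "aug_mat A B Fstar"
  have sym: "sym_mat Q" "sym_mat R" "sym_mat Xstar"
    using assms by (auto simp: psd_def pos_def_def)
  have dom: "Pstar \<in> bellman_dom"
    using assms by (simp add: riccati_Qmat_in_bellman_dom)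
  then have Pstar: "psd Pstar" "sym_mat Pstar" by (auto simp: bellman_dom_def psd_def)
  have "pos_def (R + \<gamma> *\<^sub>R (transpose B ** Xstar ** B))"
    using dom by (simp add: bellman_dom_def assms(11) block_riccati_Qmat)
  then have fix_eq: "qform Pstar w = qform (cost_mat Q R) w + \<gamma> * qform Pstar (?F *v w)" for w
    unfolding assms(10,11) by (intro qform_riccati_Qmat_fixpoint sym assms(9))
  have greedy: "greedy_gain Pstar = Fstar"
    by (simp add: assms(10,11) greedy_gain_riccati_Qmat[OF sym(3)])
  have sandwich: "sym_mat ((?T ^^ k) P) \<and> (\<forall>w. qform Pstar w \<le> qform ((?T ^^ k) P) w \<and>
      qform ((?T ^^ k) P) w - qform Pstar w \<le>
        \<gamma> ^ k * (qform P (matpow ?F k *v w) - qform Pstar (matpow ?F k *v w)))" for k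
  proof (induction k)
    case 0
    show ?case using assms(12,13) Pstar by (simp add: loewner_le_iff_qform)
  next
    case (Suc k)
    define P' where "P' = (?T ^^ k) P"
    have sym': "sym_mat P'" and lower: "\<And>w. qform Pstar w \<le> qform P' w"
      and upper: "\<And>w. qform P' w - qform Pstar w \<le>
        \<gamma> ^ k * (qform P (matpow ?F k *v w) - qform Pstar (matpow ?F k *v w))"
      using Suc by (auto simp: P'_def)
    have dom': "P' \<in> bellman_dom"
      using bellman_dom_mono[OF dom sym'] lower Pstar sym' by (simp add: loewner_le_iff_qform)
    \<comment> \<open>Lower bound: both matrices are evaluated along the gain greedy for \<open>P'\<close>, which
       cannot beat the gain \<open>Fstar\<close> greedy for \<open>Pstar\<close>.\<close>
    have "qform Pstar w \<le> qform (?T P') w" for w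
    proof -
      have "qform Pstar (?F *v w) \<le> qform Pstar (aug_mat A B (greedy_gain P') *v w)"
        using greedy_gain_minimizes_aug[OF dom] by (simp only: greedy)
      also have "\<dots> \<le> qform P' (aug_mat A B (greedy_gain P') *v w)" by (rule lower)
      finally show ?thesis
        using assms(1) by (simp add: fix_eq[of w] qform_bellman[OF dom'])
    qed
    \<comment> \<open>Upper bound: the gain \<open>Fstar\<close> is suboptimal for \<open>P'\<close> and exact for \<open>Pstar\<close>, and the stage costs
       cancel.\<close>
    moreover have "qform (?T P') w - qform Pstar w \<le>
        \<gamma> ^ Suc k * (qform P (matpow ?F (Suc k) *v w) - qform Pstar (matpow ?F (Suc k) *v w))" for w
    proof -
      have "qform (?T P') w - qform Pstar w \<le> \<gamma> * (qform P' (?F *v w) - qform Pstar (?F *v w))"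
        using qform_bellman_le[OF dom', of \<gamma> A B Q R w Fstar] assms(1)
        by (simp add: fix_eq[of w] right_diff_distrib)
      also have "\<dots> \<le> \<gamma> * (\<gamma> ^ k * (qform P (matpow ?F k *v (?F *v w))
          - qform Pstar (matpow ?F k *v (?F *v w))))"
        using upper assms(1) by (intro mult_left_mono) auto
      also have "matpow ?F k *v (?F *v w) = matpow ?F (Suc k) *v w"
        by (simp only: matrix_vector_mul_assoc matpow_Suc_right)
      finally show ?thesis by (simp add: mult.assoc)
    qed
    ultimately show ?case
      using sym_bellman[OF dom' sym(1,2)] by (simp add: P'_def)
  qed
  have "0 \<preceq> (?T ^^ k) P - Pstar \<and> (?T ^^ k) P - Pstar \<preceq>
      \<gamma> ^ k *\<^sub>R (matpow (transpose ?F) k ** (P - Pstar) ** matpow ?F k)" for k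
  proof -
    have "sym_mat (0 :: real^('n + 'm)^('n + 'm))" by (simp add: sym_mat_def transpose_0)
    moreover have "sym_mat ((?T ^^ k) P - Pstar)"
      using sandwich Pstar by (blast intro: sym_mat_diff)
    moreover have "sym_mat (\<gamma> ^ k *\<^sub>R (matpow (transpose ?F) k ** (P - Pstar) ** matpow ?F k))"
      unfolding transpose_matpow
      by (intro sym_mat_scaleR sym_mat_congruence sym_mat_diff assms(12) Pstar)
    ultimately show ?thesis
      using sandwich[of k]
      by (simp add: loewner_le_iff_qform qform_diff qform_scaleR transpose_matpow qform_congruence)
  qed
  moreover have "schur_stable (sqrt \<gamma> *\<^sub>R ?F)"
    using assms(1,2,4,7) Pstar(1) fix_eq unfolding assms(6)
    by (rule schur_stable_closed_loop)
  then have "(\<lambda>k. \<gamma> ^ k *\<^sub>R (matpow (transpose ?F) k ** (P - Pstar) ** matpow ?F k)) \<longlonglongrightarrow> 0"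
    using assms(1) by (intro discounted_congruence_tendsto_0) auto
  ultimately show ?thesis by blast
qed

end
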